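(* For every positive integer $n$, $\operatorname{OTI}(K_n)=\left[\lceil 2\sqrt n-1\rceil,\ n\right]$; that is, the minimum of $\operatorname{th}(\vec K_n)$ over all orientations $\vec K_n$ of the complete graph $K_n$ equals $\lceil 2\sqrt n-1\rceil$ and the maximum equals $n$.
   Context: An orientation of a simple undirected graph $G$ is a digraph obtained by replacing each edge $\{u,v\}$ with exactly one of the arcs $(u,v)$, $(v,u)$. Zero forcing on a digraph: vertices are blue or white; a blue vertex $u$ with exactly one white out-neighbor $w$ may force $w$ ($u\to w$), turning it blue. A set $\mathcal F$ of forces is a set of forces of $B\subseteq V$ if, starting with exactly $B$ blue, the forces in $\mathcal F$ can be validly performed in some order after which no further force is possible. Put $\mathcal F^{[0]}=B$ and $\mathcal F^{[t+1]}=\mathcal F^{[t]}\cup\{w\notin\mathcal F^{[t]}:(u\to w)\in\mathcal F,\ u\in\mathcal F^{[t]},\ w$ the only out-neighbor of $u$ outside $\mathcal F^{[t]}\}$; $\operatorname{pt}(\Gamma;\mathcal F)$ is the least $t$ with $\mathcal F^{[t]}=V$ ($\infty$ if none); $\operatorname{pt}(\Gamma;B)=\min_{\mathcal F}\operatorname{pt}(\Gamma;\mathcal F)$. The throttling number is $\operatorname{th}(\Gamma)=\min_{B\subseteq V}(|B|+\operatorname{pt}(\Gamma;B))$. The orientation throttling interval $\operatorname{OTI}(G)$ is the set of integers in $[m,M]$, where $m$ and $M$ are the minimum and maximum of $\operatorname{th}(\vec G)$ over all orientations $\vec G$ of $G$. *)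

theory Defs
  imports Complex_Main "HOL-Library.Extended_Nat" "Graph_Theory.Graph_Theory"
begin

text \<open>
  As in the Graph Theory library, an undirected graph is a symmetric digraph: an edge
  \<open>{u, v}\<close> is the pair of arcs \<open>(u, v)\<close>, \<open>(v, u)\<close>, and \<open>K\<^bsub>n\<^esub> G\<close> says that \<open>G\<close> is a complete
  simple graph on \<open>n\<close> vertices.
\<close>

definition orientation_of :: "'a pair_pre_digraph \<Rightarrow> ('a, 'b) pre_digraph \<Rightarrow> bool" where
  "orientation_of D G \<longleftrightarrow>
     pverts D = verts G \<and> parcs D \<subseteq> arcs_ends G \<and>
     (\<forall>(u, v) \<in> arcs_ends G. (u, v) \<in> parcs D \<longleftrightarrow> (v, u) \<notin> parcs D)"

definition out_neighbors :: "'a pair_pre_digraph \<Rightarrow> 'a \<Rightarrow> 'a set" where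
  "out_neighbors D u = {w. (u, w) \<in> parcs D}"

definition can_force :: "'a pair_pre_digraph \<Rightarrow> 'a set \<Rightarrow> 'a \<Rightarrow> 'a \<Rightarrow> bool" where
  "can_force D X u w \<longleftrightarrow> u \<in> X \<and> out_neighbors D u - X = {w}"

fun valid_forcing_seq :: "'a pair_pre_digraph \<Rightarrow> 'a set \<Rightarrow> ('a \<times> 'a) list \<Rightarrow> bool" where
  "valid_forcing_seq D X [] \<longleftrightarrow> True"
| "valid_forcing_seq D X ((u, w) # fs) \<longleftrightarrow>
     can_force D X u w \<and> valid_forcing_seq D (insert w X) fs"

definition set_of_forces :: "'a pair_pre_digraph \<Rightarrow> 'a set \<Rightarrow> ('a \<times> 'a) set \<Rightarrow> bool" where
  "set_of_forces D B F \<longleftrightarrow>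
     (\<exists>fs. set fs = F \<and> valid_forcing_seq D B fs \<and>
           (\<forall>u w. \<not> can_force D (B \<union> snd ` F) u w))"

fun forced_upto :: "'a pair_pre_digraph \<Rightarrow> 'a set \<Rightarrow> ('a \<times> 'a) set \<Rightarrow> nat \<Rightarrow> 'a set" where
  "forced_upto D B F 0 = B"
| "forced_upto D B F (Suc t) =
     forced_upto D B F t \<union> {w. \<exists>u. (u, w) \<in> F \<and> can_force D (forced_upto D B F t) u w}"

definition pt_forces :: "'a pair_pre_digraph \<Rightarrow> 'a set \<Rightarrow> ('a \<times> 'a) set \<Rightarrow> enat" where
  "pt_forces D B F =
     (if \<exists>t. forced_upto D B F t = pverts D
      then enat (LEAST t. forced_upto D B F t = pverts D) else \<infinity>)"

text \<open>
  Type \<^typ>\<open>enat\<close> is well-ordered, so the infima below are attained minima whenever they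
  range over a nonempty set.
\<close>

definition pt :: "'a pair_pre_digraph \<Rightarrow> 'a set \<Rightarrow> enat" where
  "pt D B = (INF F \<in> {F. set_of_forces D B F}. pt_forces D B F)"

definition th :: "'a pair_pre_digraph \<Rightarrow> enat" where
  "th D = (INF B \<in> {B. B \<subseteq> pverts D}. enat (card B) + pt D B)"

definition min_orientation_th :: "('a, 'b) pre_digraph \<Rightarrow> enat" where
  "min_orientation_th G = Min {th D |D. orientation_of D G}"

definition max_orientation_th :: "('a, 'b) pre_digraph \<Rightarrow> enat" where
  "max_orientation_th G = Max {th D |D. orientation_of D G}"

definition OTI :: "('a, 'b) pre_digraph \<Rightarrow> int set" where
  "OTI G = int ` {k. min_orientation_th G \<le> enat k \<and> enat k \<le> max_orientation_th G}"

end

theory Submission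
  imports Defs
begin

text \<open>
  Call a blue vertex active if it still has a white out-neighbor. A force deactivates its source
  and turns only its target blue, so a time step never increases the number of active vertices;
  hence at most \<open>|B|\<close> vertices are forced per step, \<open>n \<le> |B| (pt + 1)\<close>, and AM-GM gives the lower
  bound \<open>2 \<surd>n - 1\<close>. It is attained on \<open>{0..<n}\<close> by orienting every pair downwards except
  \<open>i \<rightarrow> i + k\<close>, where \<open>k\<close> is half of \<open>\<lceil>2 \<surd>n\<rceil>\<close>: then \<open>{0..<k}\<close> forces \<open>k\<close> new vertices per step.
  In a transitive tournament only the last white vertex can ever be forced, so each step forces at
  most one vertex and the throttling number is \<open>n\<close>.
\<close>

section \<open>Bounding throttling numbers by propagation times\<close>

lemma can_force_unique: "can_force D X u w \<Longrightarrow> can_force D X u w' \<Longrightarrow> w = w'"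
  by (auto simp: can_force_def)

lemma forced_upto_mono: "s \<le> t \<Longrightarrow> forced_upto D B F s \<subseteq> forced_upto D B F t"
  by (rule lift_Suc_mono_le[of "forced_upto D B F"]) auto

lemma th_geI:
  assumes "\<And>B F t. B \<subseteq> pverts D \<Longrightarrow> forced_upto D B F t = pverts D \<Longrightarrow> m \<le> card B + t"
  shows "enat m \<le> th D"
  unfolding th_def
proof (rule INF_greatest)
  fix B assume "B \<in> {B. B \<subseteq> pverts D}"
  then have B: "B \<subseteq> pverts D" by simp
  \<comment> \<open>Truncated subtraction covers \<open>m < card B\<close> as well: adding
    \<open>card B\<close> back always yields at least \<open>m\<close>. Force sets that never color
    everything have time \<open_infinity>.\<close>
  have "enat (m - card B) \<le> pt D B"
    unfolding pt_def
  proof (rule INF_greatest)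
    fix F
    have "m - card B \<le> (LEAST t. forced_upto D B F t = pverts D)"
      if "\<exists>t. forced_upto D B F t = pverts D"
      using assms[OF B LeastI_ex[OF that]] by simp
    then show "enat (m - card B) \<le> pt_forces D B F"
      by (simp add: pt_forces_def)
  qed
  then have "enat (card B) + enat (m - card B) \<le> enat (card B) + pt D B"
    by (rule add_left_mono)
  then show "enat m \<le> enat (card B) + pt D B"
    by (rule order_trans[rotated]) simp
qed

lemma th_leI:
  assumes "B \<subseteq> pverts D" "set_of_forces D B F" "forced_upto D B F t = pverts D"
  shows "th D \<le> enat (card B + t)"
proof -
  have "pt_forces D B F \<le> enat t"
    using assms(3) by (auto simp: pt_forces_def intro: Least_le)
  then have "pt D B \<le> enat t"
    unfolding pt_def using assms(2) by (auto intro: INF_lower2)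
  then have "enat (card B) + pt D B \<le> enat (card B) + enat t"
    by (rule add_left_mono)
  then show ?thesis
    unfolding th_def using assms(1) by (auto intro: INF_lower2)
qed

text \<open>Take every vertex as initially blue, with no forces and time 0.\<close>

lemma th_le_card:
  assumes "parcs D \<subseteq> pverts D \<times> pverts D"
  shows "th D \<le> enat (card (pverts D))"
proof -
  have "\<not> can_force D (pverts D) u w" for u w
    using assms by (auto simp: can_force_def out_neighbors_def)
  then show ?thesis
    using th_leI[of "pverts D" D "{}" 0] by (simp add: set_of_forces_def)
qed

section \<open>The square-root lower bound\<close>

definition active :: "'a pair_pre_digraph \<Rightarrow> 'a set \<Rightarrow> 'a set" where
  "active D X = {u \<in> X. \<not> out_neighbors D u \<subseteq> X}"

text \<open>Choosing a forcer for each vertex of \<open>N\<close> is injective, since a vertex can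
  force only one target, and every forcer is active beforehand. Its only white out-neighbor lies in
  \<open>N\<close>, so it is inactive afterwards. The loss of the forcers pays for the new vertices
  of \<open>N\<close>.\<close>

lemma forcing_step:
  assumes fin: "finite X" and N: "\<And>w. w \<in> N \<Longrightarrow> \<exists>u. can_force D X u w"
  shows "finite N" "card N \<le> card (active D X)" "card (active D (X \<union> N)) \<le> card (active D X)"
proof -
  obtain h where h: "\<And>w. w \<in> N \<Longrightarrow> can_force D X (h w) w"
    using N by metis
  have inj: "inj_on h N"
    by (metis inj_onI can_force_unique h)
  have sub: "h ` N \<subseteq> active D X"
    using h by (auto simp: active_def can_force_def)
  have finA: "finite (active D X)"
    using fin by (simp add: active_def)
  show finN: "finite N"
    using inj sub finA by (rule inj_on_finite)
  show le: "card N \<le> card (active D X)"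
    using inj sub finA by (rule card_inj_on_le)
  have deactivated: "out_neighbors D (h w) \<subseteq> X \<union> N" if "w \<in> N" for w
  proof -
    have "out_neighbors D (h w) - X \<subseteq> {w}"
      using h[OF that] by (simp add: can_force_def)
    then show ?thesis using that by blast
  qed
  have "active D (X \<union> N) \<subseteq> (active D X - h ` N) \<union> N"
    unfolding active_def using deactivated by blast
  then have "card (active D (X \<union> N)) \<le> card ((active D X - h ` N) \<union> N)"
    using finA finN by (intro card_mono) auto
  also have "\<dots> \<le> card (active D X - h ` N) + card N"
    by (rule card_Un_le)
  also have "\<dots> = card (active D X)"
    using le finN sub by (simp add: card_Diff_subset card_image[OF inj])
  finally show "card (active D (X \<union> N)) \<le> card (active D X)" .
qed

lemma card_forced_upto_le:
  assumes "finite B"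
  shows "card (forced_upto D B F t) \<le> card B * (t + 1)"
proof -
  \<comment> \<open>The bound on active vertices is carried through the induction because it limits
    the growth of each single step to \<open>card B\<close>.\<close>
  have "finite (forced_upto D B F t) \<and> card (active D (forced_upto D B F t)) \<le> card B \<and>
    card (forced_upto D B F t) \<le> card B * (t + 1)"
  proof (induction t)
    case 0
    have "card (active D B) \<le> card B"
      using assms by (intro card_mono) (auto simp: active_def)
    then show ?case using assms by simp
  next
    case (Suc t)
    let ?X = "forced_upto D B F t"
    let ?N = "{w. \<exists>u. (u, w) \<in> F \<and> can_force D ?X u w}"
    have "finite ?N" "card ?N \<le> card (active D ?X)"
      "card (active D (?X \<union> ?N)) \<le> card (active D ?X)"
      using forcing_step[of ?X ?N D] Suc.IH by blast+
    moreover have "card (?X \<union> ?N) \<le> card ?X + card ?N"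
      by (rule card_Un_le)
    ultimately show ?case using Suc.IH by simp
  qed
  then show ?thesis by simp
qed

lemma th_ge_sqrt:
  assumes "finite (pverts D)"
  shows "enat (nat \<lceil>2 * sqrt (real (card (pverts D))) - 1\<rceil>) \<le> th D"
proof (rule th_geI)
  fix B F t
  assume B: "B \<subseteq> pverts D" and F: "forced_upto D B F t = pverts D"
  let ?n = "real (card (pverts D))"
  let ?b = "real (card B)"
  have "card (pverts D) \<le> card B * (t + 1)"
    using card_forced_upto_le[of B D F t] finite_subset[OF B assms] F by simp
  then have "?n \<le> ?b * (real t + 1)"
    by (metis of_nat_1 of_nat_add of_nat_le_iff of_nat_mult)
  \<comment> \<open>AM-GM for the factors \<open>card B\<close> and \<open>t + 1\<close>.\<close>
  moreover have "4 * (?b * (real t + 1)) \<le> (?b + real t + 1)\<^sup>2"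
    using zero_le_power2[of "?b - (real t + 1)"] by (simp add: power2_eq_square algebra_simps)
  ultimately have "?n \<le> ((?b + real t + 1) / 2)\<^sup>2"
    by (simp add: power_divide)
  then have "sqrt ?n \<le> (?b + real t + 1) / 2"
    by (intro real_le_lsqrt) auto
  then have "2 * sqrt ?n - 1 \<le> of_int (int (card B + t))"
    by simp
  then have "\<lceil>2 * sqrt ?n - 1\<rceil> \<le> int (card B + t)"
    by (simp only: ceiling_le_iff)
  then show "nat \<lceil>2 * sqrt ?n - 1\<rceil> \<le> card B + t"
    by simp
qed

section \<open>Transitive tournaments\<close>

lemma th_ge_card_if_transitive_tournament:
  assumes "finite (pverts D)" "parcs D \<subseteq> pverts D \<times> pverts D"
    and "trans (parcs D)" "total_on (pverts D) (parcs D)"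
  shows "enat (card (pverts D)) \<le> th D"
proof (rule th_geI)
  fix B F t
  assume B: "B \<subseteq> pverts D" and F: "forced_upto D B F t = pverts D"
  \<comment> \<open>If distinct white \<open>w\<close>, \<open>w'\<close> were both forceable, with
    an arc from \<open>w\<close> to \<open>w'\<close> say, transitivity would make \<open>w'\<close>
    a second white out-neighbor of the vertex forcing \<open>w\<close>.\<close>
  have unique: "w = w'" if "can_force D X u w" "can_force D X u' w'" for X u u' w w'
  proof (rule ccontr)
    assume "w \<noteq> w'"
    have arcs: "(u, w) \<in> parcs D" "(u', w') \<in> parcs D" "w \<notin> X" "w' \<notin> X"
      using that by (auto simp: can_force_def out_neighbors_def)
    then have "(w, w') \<in> parcs D \<or> (w', w) \<in> parcs D"
      using assms(2,4) \<open>w \<noteq> w'\<close> by (auto simp: total_on_def)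
    then have "(u, w') \<in> parcs D \<or> (u', w) \<in> parcs D"
      using arcs assms(3) by (meson transD)
    then show False
      using that arcs \<open>w \<noteq> w'\<close> by (auto simp: can_force_def out_neighbors_def)
  qed
  have "card (forced_upto D B F t) \<le> card B + t" for t
  proof (induction t)
    case (Suc t)
    let ?X = "forced_upto D B F t"
    let ?N = "{w. \<exists>u. (u, w) \<in> F \<and> can_force D ?X u w}"
    have "card ?N \<le> 1"
    proof (cases "?N = {}")
      case True
      then show ?thesis by (metis card.empty zero_le)
    next
      case False
      then obtain w where "w \<in> ?N" by blast
      then have "?N = {w}" using unique[of ?X] by blast
      then show ?thesis by simp
    qed
    then show ?case
      using card_Un_le[of ?X ?N] Suc.IH by simp
  qed simp
  then show "card (pverts D) \<le> card B + t"
    using F by metis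
qed

section \<open>The orientation with upward arcs of stride \<open>k\<close>, on vertices labelled by
  \<open>g\<close>\<close>

context
  fixes D :: "'a pair_pre_digraph" and g :: "nat \<Rightarrow> 'a" and n k :: nat
  assumes k: "0 < k" "k \<le> n"
    and g: "bij_betw g {..<n} (pverts D)"
    and parcs: "parcs D = {(g i, g j) |i j. i < n \<and> j < n \<and> (j = i + k \<or> j < i \<and> i \<noteq> j + k)}"
begin

lemma stride_out_neighbors:
  assumes "i < n"
  shows "out_neighbors D (g i) = g ` {j. j < n \<and> (j = i + k \<or> j < i \<and> i \<noteq> j + k)}"
proof -
  have "i' = i" if "g i = g i'" "i' < n" for i'
    using that assms g by (auto simp: bij_betw_def inj_on_def)
  then show ?thesis
    unfolding out_neighbors_def parcs using assms by blast
qed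

text \<open>Apart from \<open>i + k\<close>, all out-neighbors of \<open>i\<close> have smaller
  labels and are therefore already blue.\<close>

lemma stride_can_force:
  assumes "i + k < n" "g ` {..i} \<subseteq> X" "g (i + k) \<notin> X"
  shows "can_force D X (g i) (g (i + k))"
proof -
  have "out_neighbors D (g i) - X \<subseteq> {g (i + k)}"
    using assms by (auto simp: stride_out_neighbors image_subset_iff)
  moreover have "g (i + k) \<in> out_neighbors D (g i)"
    using assms by (auto simp: stride_out_neighbors)
  ultimately show ?thesis
    using assms by (auto simp: can_force_def)
qed

lemma stride_valid:
  assumes "i \<le> n - k"
  shows "valid_forcing_seq D (g ` {..<i + k}) (map (\<lambda>i. (g i, g (i + k))) [i..<n - k])"
  using assms
\<comment> \<open>The induction descends from \<open>n - k\<close>, the empty list, because a valid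
  sequence is unfolded at its head. Before force \<open>i\<close> the blue labels are exactly those
  below \<open>i + k\<close>.\<close>
proof (induction rule: inc_induct)
  case (step i)
  have "g (i + k) \<notin> g ` {..<i + k}"
    using step.hyps inj_on_image_mem_iff[OF bij_betw_imp_inj_on[OF g], of "i + k" "{..<i + k}"]
    by auto
  then have "can_force D (g ` {..<i + k}) (g i) (g (i + k))"
    using step.hyps k by (intro stride_can_force) auto
  moreover have "insert (g (i + k)) (g ` {..<i + k}) = g ` {..<Suc i + k}"
    by (simp add: lessThan_Suc)
  ultimately show ?case
    using step by (simp add: upt_conv_Cons)
qed simp

definition stride_forces :: "('a \<times> 'a) set" where
  "stride_forces = (\<lambda>i. (g i, g (i + k))) ` {..<n - k}"

lemma stride_set_of_forces: "set_of_forces D (g ` {..<k}) stride_forces"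
proof -
  \<comment> \<open>Every label is initially blue or the target of the label \<open>k\<close> below
    it. So the forces end with all vertices blue and nothing left to force.\<close>
  have "{..<n} = {..<k} \<union> (\<lambda>i. i + k) ` {..<n - k}"
  proof -
    have "j \<in> {..<k} \<union> (\<lambda>i. i + k) ` {..<n - k}" if "j < n" for j
      using that by (cases "j < k") (auto intro: rev_image_eqI[of "j - k"])
    then show ?thesis using k by auto
  qed
  then have "g ` {..<k} \<union> snd ` stride_forces = pverts D"
    using g by (auto simp: bij_betw_def stride_forces_def image_Un image_image)
  moreover have "\<not> can_force D (pverts D) u w" for u w
  proof -
    have "out_neighbors D u \<subseteq> pverts D"
      using bij_betw_imp_surj_on[OF g] by (auto simp: out_neighbors_def parcs)
    then show ?thesis by (auto simp: can_force_def)
  qed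
  ultimately show ?thesis
    using stride_valid[of 0] unfolding set_of_forces_def
    by (intro exI[of _ "map (\<lambda>i. (g i, g (i + k))) [0..<n - k]"])
      (auto simp: stride_forces_def atLeast0LessThan)
qed

lemma stride_forced_upto_subset: "forced_upto D (g ` {..<k}) stride_forces t \<subseteq> pverts D"
  using g k by (induction t) (auto simp: stride_forces_def bij_betw_def)

text \<open>One step advances the blue initial segment by \<open>k\<close>: if
  \<open>j < (t + 2) * k\<close>, then \<open>j - k\<close> and all labels below it are blue at time
  \<open>t\<close>, so \<open>j - k\<close> can force \<open>j\<close>.\<close>

lemma stride_forced_upto_superset:
  "j < n \<Longrightarrow> j < (t + 1) * k \<Longrightarrow> g j \<in> forced_upto D (g ` {..<k}) stride_forces t"
proof (induction t arbitrary: j)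
  case (Suc t)
  let ?X = "forced_upto D (g ` {..<k}) stride_forces"
  show ?case
  proof (cases "g j \<in> ?X t \<or> j < k")
    case True
    then show ?thesis
      using forced_upto_mono[of 0 t D "g ` {..<k}" stride_forces] by auto
  next
    case False
    define i where "i = j - k"
    have i: "j = i + k" "i + k < n" "i < (t + 1) * k"
      using False Suc.prems by (auto simp: i_def)
    have "g ` {..i} \<subseteq> ?X t"
      using i Suc.IH by auto
    then have "can_force D (?X t) (g i) (g j)"
      using stride_can_force[of i "?X t"] i False by auto
    then show ?thesis
      using i by (auto simp: stride_forces_def)
  qed
qed simp

lemma stride_th_le:
  assumes "n \<le> (t + 1) * k"
  shows "th D \<le> enat (k + t)"
proof -
  have "pverts D \<subseteq> forced_upto D (g ` {..<k}) stride_forces t"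
    using stride_forced_upto_superset[of _ t] assms
    unfolding bij_betw_imp_surj_on[OF g, symmetric] by auto
  then have "forced_upto D (g ` {..<k}) stride_forces t = pverts D"
    using stride_forced_upto_subset by blast
  moreover have "g ` {..<k} \<subseteq> pverts D"
    using g k by (auto simp: bij_betw_def)
  moreover have "card (g ` {..<k}) = k"
    using g k by (subst card_image) (auto simp: bij_betw_def intro: inj_on_subset)
  ultimately show ?thesis
    using th_leI[OF _ stride_set_of_forces, of t] by simp
qed

end

section \<open>Integer parameters attaining the bound\<close>

lemma half_ceiling_two_sqrt:
  assumes "n > 0"
  obtains k t where "0 < k" "k \<le> n" "n \<le> (t + 1) * k"
    "k + t = nat \<lceil>2 * sqrt (real n) - 1\<rceil>"
proof -
  define m where "m = nat \<lceil>2 * sqrt (real n)\<rceil>"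
  \<comment> \<open>Given the sum \<open>m\<close> of the factors \<open>k\<close> and
    \<open>t + 1 = m - k\<close>, an equal split maximizes their product.\<close>
  define k where "k = m div 2"
  have "1 \<le> sqrt (real n)"
    using assms by simp
  then have "1 < 2 * sqrt (real n)"
    by linarith
  then have "2 \<le> \<lceil>2 * sqrt (real n)\<rceil>"
    by (subst le_ceiling_iff) simp
  then have m2: "2 \<le> m" and m: "real m = of_int \<lceil>2 * sqrt (real n)\<rceil>"
    unfolding m_def by linarith+
  \<comment> \<open>This gives \<open>m \<le> 2 * n\<close> and hence \<open>k \<le> n\<close>, so
    that \<open>k\<close> initial vertices exist.\<close>
  have "sqrt (real n) \<le> real n"
    using assms by (intro real_le_lsqrt) (auto simp: power2_eq_square)
  then have "\<lceil>2 * sqrt (real n)\<rceil> \<le> int (2 * n)"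
    by (simp add: ceiling_le_iff)
  then have "m \<le> 2 * n"
    unfolding m_def by linarith
  have "2 * sqrt (real n) \<le> real m"
    by (simp add: m)
  then have "(2 * sqrt (real n))\<^sup>2 \<le> (real m)\<^sup>2"
    by (intro power_mono) auto
  then have "real (4 * n) \<le> real (m\<^sup>2)"
    by (simp add: power_mult_distrib)
  then have sq: "4 * n \<le> m\<^sup>2"
    by (simp only: of_nat_le_iff)
  have "n \<le> (m - k) * k"
  proof (cases "even m")
    case True
    then have "m = 2 * k" by (simp add: k_def)
    then show ?thesis using sq by (simp add: power2_eq_square)
  next
    case False
    then have "m = 2 * k + 1" by (simp add: k_def)
    \<comment> \<open>The surplus 1 vanishes by integrality, both other terms being multiples of
      4.\<close>
    then have "4 * n \<le> 4 * ((k + 1) * k) + 1"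
      using sq by (simp add: power2_eq_square algebra_simps)
    then show ?thesis using \<open>m = 2 * k + 1\<close> by simp
  qed
  moreover have "m - k - 1 + 1 = m - k" "k + (m - k - 1) = m - 1" "0 < k" "k \<le> n"
    using m2 \<open>m \<le> 2 * n\<close> by (auto simp: k_def)
  moreover have "nat \<lceil>2 * sqrt (real n) - 1\<rceil> = m - 1"
    by (simp add: m_def nat_diff_distrib')
  ultimately show ?thesis
    using that[of k "m - k - 1"] by metis
qed

section \<open>Extremal orientations of the complete graph\<close>

lemma orientation_of_complete_digraphI:
  assumes "K\<^bsub>n\<^esub> G" "bij_betw g {..<n} (verts G)"
    and "\<And>i j. i < n \<Longrightarrow> j < n \<Longrightarrow> i \<noteq> j \<Longrightarrow> R i j \<longleftrightarrow> \<not> R j i" "\<And>i. \<not> R i i"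
  shows "orientation_of \<lparr>pverts = verts G, parcs = {(g i, g j) |i j. i < n \<and> j < n \<and> R i j}\<rparr> G"
proof -
  define A where "A = {(g i, g j) |i j. i < n \<and> j < n \<and> R i j}"
  have inj: "i = j" if "g i = g j" "i < n" "j < n" for i j
    using that assms(2) by (auto simp: bij_betw_def inj_on_def)
  have verts: "verts G = g ` {..<n}"
    using assms(2) by (simp add: bij_betw_def)
  have ends: "arcs_ends G = {(u, v). u \<in> verts G \<and> v \<in> verts G \<and> u \<noteq> v}"
    using assms(1) by (auto simp: complete_digraph_def)
  \<comment> \<open>Injectivity of \<open>g\<close> turns questions about arcs into questions about
    labels.\<close>
  have mem: "(g i, g j) \<in> A \<longleftrightarrow> R i j" if "i < n" "j < n" for i j
    unfolding A_def using that inj by blast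
  have "A \<subseteq> arcs_ends G"
    using inj assms(4) by (fastforce simp: ends verts A_def)
  moreover have "(u, v) \<in> A \<longleftrightarrow> (v, u) \<notin> A" if uv: "(u, v) \<in> arcs_ends G" for u v
  proof -
    obtain i j where ij: "u = g i" "v = g j" "i < n" "j < n" "i \<noteq> j"
      using uv unfolding ends verts by blast
    show ?thesis
      unfolding ij(1,2) mem[OF ij(3,4)] mem[OF ij(4,3)] by (rule assms(3)[OF ij(3-5)])
  qed
  ultimately show ?thesis
    by (auto simp: orientation_of_def simp flip: A_def)
qed

theorem theorem3p7:
  fixes G :: "('a, 'b) pre_digraph" and n :: nat
  assumes "n > 0" and "K\<^bsub>n\<^esub> G"
  shows "OTI G = {\<lceil>2 * sqrt (real n) - 1\<rceil>..int n} \<and>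
         min_orientation_th G = enat (nat \<lceil>2 * sqrt (real n) - 1\<rceil>) \<and>
         max_orientation_th G = enat n"
proof -
  let ?c = "\<lceil>2 * sqrt (real n) - 1\<rceil>"
  let ?S = "{th D |D. orientation_of D G}"
  have card: "card (verts G) = n"
    using assms(2) by (simp add: complete_digraph_def)
  have fin: "finite (verts G)"
    using card assms(1) by (simp add: card_ge_0_finite)
  obtain g where g: "bij_betw g {..<n} (verts G)"
    using ex_bij_betw_nat_finite[OF fin] card by (auto simp: atLeast0LessThan)
  have upper: "x \<le> enat n" if "x \<in> ?S" for x
  proof -
    obtain D where D: "x = th D" "orientation_of D G"
      using \<open>x \<in> ?S\<close> by blast
    then have "parcs D \<subseteq> pverts D \<times> pverts D" "pverts D = verts G"
      using assms(2) by (auto simp: orientation_of_def complete_digraph_def)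
    then show ?thesis
      using th_le_card[of D] D card by simp
  qed
  have lower: "enat (nat ?c) \<le> x" if "x \<in> ?S" for x
  proof -
    obtain D where D: "x = th D" "orientation_of D G"
      using \<open>x \<in> ?S\<close> by blast
    then show ?thesis
      using th_ge_sqrt[of D] fin card by (simp add: orientation_of_def)
  qed
  \<comment> \<open>\<open>Min\<close> and \<open>Max\<close> are only meaningful on finite sets; a
    set of extended naturals bounded by \<open>n\<close> is finite.\<close>
  have finS: "finite ?S"
    using upper by (intro finite_enat_bounded) auto
  have "enat (nat ?c) \<in> ?S"
  proof -
    obtain k t where kt: "0 < k" "k \<le> n" "n \<le> (t + 1) * k" "k + t = nat ?c"
      using half_ceiling_two_sqrt[OF assms(1)] .
    \<comment> \<open>Pairs of labels at distance \<open>k\<close> point upwards, all others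
      downwards; \<open>0 < k\<close> excludes loops.\<close>
    define R where "R i j \<longleftrightarrow> j = i + k \<or> j < i \<and> i \<noteq> j + k" for i j
    define D where "D = \<lparr>pverts = verts G, parcs = {(g i, g j) |i j. i < n \<and> j < n \<and> R i j}\<rparr>"
    have "orientation_of D G"
      unfolding D_def using assms(2) g kt(1)
      by (intro orientation_of_complete_digraphI) (auto simp: R_def)
    moreover have "th D \<le> enat (k + t)"
      by (rule stride_th_le[OF kt(1,2) _ _ kt(3)]) (use g in \<open>simp_all add: D_def R_def\<close>)
    ultimately show ?thesis
      using lower[of "th D"] kt(4) by (metis (mono_tags, lifting) CollectI order_antisym)
  qed
  then have min: "min_orientation_th G = enat (nat ?c)"
    unfolding min_orientation_th_def using finS lower by (intro Min_eqI)
  have "enat n \<in> ?S"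
  proof -
    define D where "D = \<lparr>pverts = verts G, parcs = {(g i, g j) |i j. i < n \<and> j < n \<and> i < j}\<rparr>"
    have inj: "i = j" if "g i = g j" "i < n" "j < n" for i j
      using that g by (auto simp: bij_betw_def inj_on_def)
    have verts: "pverts D = g ` {..<n}"
      using g by (simp add: D_def bij_betw_def)
    have D: "orientation_of D G"
      unfolding D_def using assms(2) g by (intro orientation_of_complete_digraphI) auto
    have "parcs D \<subseteq> pverts D \<times> pverts D"
      by (auto simp: verts) (auto simp: D_def)
    moreover have "trans (parcs D)"
      by (rule transI) (auto simp: D_def dest!: inj, metis order.strict_trans)
    moreover have "total_on (pverts D) (parcs D)"
      unfolding total_on_def verts by (auto simp: D_def) (metis nat_neq_iff)
    ultimately have "enat n \<le> th D"
      using th_ge_card_if_transitive_tournament[of D] fin card by (simp add: D_def)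
    then show ?thesis
      using upper[of "th D"] D by (metis (mono_tags, lifting) CollectI order_antisym)
  qed
  then have max: "max_orientation_th G = enat n"
    unfolding max_orientation_th_def using finS upper by (intro Max_eqI)
  \<comment> \<open>Nonnegativity of the ceiling ensures that passing through \<open>nat\<close>
    does not change the lower endpoint.\<close>
  have "1 \<le> sqrt (real n)"
    using assms(1) by simp
  then have "0 \<le> ?c"
    by (simp add: le_ceiling_iff)
  have "OTI G = {?c..int n}"
  proof -
    have "x \<in> int ` {k. nat ?c \<le> k \<and> k \<le> n}" if "?c \<le> x" "x \<le> int n" for x
    proof (rule image_eqI)
      show "x = int (nat x)" "nat x \<in> {k. nat ?c \<le> k \<and> k \<le> n}"
        using order_trans[OF \<open>0 \<le> ?c\<close> that(1)] that by (simp_all add: nat_mono nat_le_iff)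
    qed
    then show ?thesis
      using \<open>0 \<le> ?c\<close> by (auto simp: OTI_def min max)
  qed
  then show ?thesis using min max by simp
qed

end
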